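(* Let $d,K\ge1$ be integers, $\alpha>0$, and let $\mathcal{H}$ be a finite collection of realizations of a $d$-dimensional point process. Then the function $X\mapsto\mathcal{L}^K(X,\mathcal{H})$, the log-likelihood of $\mathcal{H}$ under the $K$-approximated multivariate Hawkes model expressed as a function of the vector $X\in\mathbb{R}^{d(d+1)K}$ of linear coefficients, is concave (as a function with values in $\mathbb{R}\cup\{-\infty\}$).
   Context: A realization $h\in\mathcal{H}$ consists of an observation period $[T_h^-,T_h^+]$ with $0\le T_h^-\le T_h^+$ and finitely many events $(t_i^h,u_i^h)$, $i=1,\dots,n_h$, where $t_i^h\in[T_h^-,T_h^+]$ is the time and $u_i^h\in\{1,\dots,d\}$ the type of the $i$-th event. Write $x_+=\max(x,0)$ and $\ln(x)=-\infty$ for $x\le0$. The coefficient vector is $X=(X_{uv,k})$ with $u\in\{1,\dots,d\}$, $v\in\{0,1,\dots,d\}$, $k\in\{1,\dots,K\}$; here $u$ is the type of the affected events, $v\ge1$ the type of the triggering events, and $v=0$ corresponds to the background rate. For $h\in\mathcal{H}$, $u\in\{1,\dots,d\}$ and $s\in[T_h^-,T_h^+]$, define the linear form in $X$ $$\Lambda^{h}_u(s;X)=\sum_{k=1}^K X_{u0,k}\,e^{-k\alpha s}+\sum_{v=1}^d\sum_{k=1}^K X_{uv,k}\sum_{j:\,t_j^h<s,\ u_j^h=v}e^{-(k+1)\alpha(s-t_j^h)} .$$ The approximate log-likelihood is $$\mathcal{L}^K(X,\mathcal{H})=\sum_{h\in\mathcal{H}}\sum_{i=1}^{n_h}\ln\big(\Lambda^h_{u_i^h}(t_i^h;X)\big)-\sum_{h\in\mathcal{H}}\sum_{u=1}^d\int_{T_h^-}^{T_h^+}\big(\Lambda^h_u(s;X)\big)_+\,ds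 .$$ *)

theory Defs
  imports "HOL-Analysis.Analysis" "HOL-Library.Multiset"
begin

text \<open>Events are (time, type) pairs. The list form allows repeated events, and the list need not
  be sorted by time.\<close>

record realization =
  period_start :: real
  period_end :: real
  events :: "(real \<times> nat) list"

definition n_events :: "realization \<Rightarrow> nat" where
  "n_events h = length (events h)"

definition event_time :: "realization \<Rightarrow> nat \<Rightarrow> real" where
  "event_time h i = fst (events h ! i)"

definition event_type :: "realization \<Rightarrow> nat \<Rightarrow> nat" where
  "event_type h i = snd (events h ! i)"

definition valid_realization :: "nat \<Rightarrow> realization \<Rightarrow> bool" where
  "valid_realization d h \<longleftrightarrow>
     0 \<le> period_start h \<and> period_start h \<le> period_end h \<and>
     (\<forall>i<n_events h. event_time h i \<in> {period_start h..period_end h} \<and> event_type h i \<in> {1..d})"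

text \<open>The space \<open>\<real>\<^sup>I\<close> for an index set \<open>I\<close>, encoded as the functions that vanish outside \<open>I\<close>.\<close>

definition vectors_on :: "'i set \<Rightarrow> ('i \<Rightarrow> real) set" where
  "vectors_on I = {X. \<forall>i. i \<notin> I \<longrightarrow> X i = 0}"

text \<open>The coefficient \<open>X\<^bsub>uv,k\<^esub>\<close> is \<open>X (u, v, k)\<close>; \<open>v = 0\<close> stands for the background rate.
  The index set has \<open>d (d + 1) K\<close> elements.\<close>

definition coeff_index :: "nat \<Rightarrow> nat \<Rightarrow> (nat \<times> nat \<times> nat) set" where
  "coeff_index d K = {1..d} \<times> {0..d} \<times> {1..K}"

definition intensity ::
  "nat \<Rightarrow> nat \<Rightarrow> real \<Rightarrow> realization \<Rightarrow> nat \<Rightarrow> real \<Rightarrow> (nat \<times> nat \<times> nat \<Rightarrow> real) \<Rightarrow> real" where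
  "intensity d K \<alpha> h u s X =
     (\<Sum>k=1..K. X (u, 0, k) * exp (- real k * \<alpha> * s)) +
     (\<Sum>v=1..d. \<Sum>k=1..K. X (u, v, k) *
        (\<Sum>j | j < n_events h \<and> event_time h j < s \<and> event_type h j = v.
           exp (- real (k + 1) * \<alpha> * (s - event_time h j))))"

text \<open>The library's \<open>ln\<close> is real-valued, so the value \<open>-\<infinity>\<close> at nonpositive arguments is added here.\<close>

definition ext_ln :: "real \<Rightarrow> ereal" where
  "ext_ln x = (if x \<le> 0 then - \<infinity> else ereal (ln x))"

definition log_likelihood ::
  "nat \<Rightarrow> nat \<Rightarrow> real \<Rightarrow> realization multiset \<Rightarrow> (nat \<times> nat \<times> nat \<Rightarrow> real) \<Rightarrow> ereal" where
  "log_likelihood d K \<alpha> H X =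
     (\<Sum>h\<in>#H. \<Sum>i<n_events h. ext_ln (intensity d K \<alpha> h (event_type h i) (event_time h i) X)) -
     ereal (\<Sum>h\<in>#H. \<Sum>u=1..d.
       integral {period_start h..period_end h} (\<lambda>s. max (intensity d K \<alpha> h u s X) 0))"

text \<open>Concavity for functions with values in \<open>\<real> \<union> {-\<infinity>}\<close>; the library's \<open>concave_on\<close> only covers
  real-valued functions. In \<open>ereal\<close>, \<open>0 * (-\<infinity>) = 0\<close>, so the endpoints \<open>t = 0\<close> and \<open>t = 1\<close> are
  harmless. As \<open>f\<close> never takes the value \<open>\<infinity>\<close>, no sum \<open>\<infinity> + (-\<infinity>)\<close> occurs.\<close>

definition ext_concave_on :: "('i \<Rightarrow> real) set \<Rightarrow> (('i \<Rightarrow> real) \<Rightarrow> ereal) \<Rightarrow> bool" where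
  "ext_concave_on S f \<longleftrightarrow>
     (\<forall>X\<in>S. f X \<noteq> \<infinity>) \<and>
     (\<forall>X\<in>S. \<forall>Y\<in>S. \<forall>t\<in>{0..1}.
        (\<lambda>i. (1 - t) * X i + t * Y i) \<in> S \<and>
        ereal (1 - t) * f X + ereal t * f Y \<le> f (\<lambda>i. (1 - t) * X i + t * Y i))"

end

theory Submission imports Defs begin

text \<open>The intensity at a fixed realization, type and time is a linear form in the coefficients.
  Each event therefore contributes the concave function \<open>ln\<close>, extended by \<open>-\<infinity>\<close>, of a linear form,
  and the compensator is an integral of positive parts of linear forms, hence convex. Concave
  functions with values in \<open>\<real> \<union> {-\<infinity>}\<close> are closed under finite sums, so subtracting the
  compensator keeps the log-likelihood concave.

  The pointwise convexity of the positive part passes to the compensator only because the integrals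
  exist: the default value \<open>0\<close> of a missing integral need not respect inequalities. In time, the
  intensity is a finite combination of exponentials cut off at the event times, hence absolutely
  integrable on every compact interval (\<open>intensity_absolutely_integrable\<close>).\<close>

section \<open>Concave functions with values in the reals and minus infinity\<close>

text \<open>Convexity for the pointwise operations on functions: the predicate \<open>convex\<close> presupposes a
  type of class \<open>real_vector\<close>.\<close>

definition pointwise_convex :: "('i \<Rightarrow> real) set \<Rightarrow> bool" where
  "pointwise_convex S \<longleftrightarrow>
     (\<forall>X\<in>S. \<forall>Y\<in>S. \<forall>t\<in>{0..1}. (\<lambda>i. (1 - t) * X i + t * Y i) \<in> S)"

lemma pointwise_convex_vectors_on: "pointwise_convex (vectors_on I)"
  by (simp add: pointwise_convex_def vectors_on_def)

text \<open>A real-valued function needs only the inequality in \<open>\<real>\<close>; both the empty sum and the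
  negated compensator enter through this rule.\<close>

lemma ext_concave_on_real:
  assumes "pointwise_convex S"
    and "\<And>X Y t. \<lbrakk>X \<in> S; Y \<in> S; 0 \<le> t; t \<le> 1\<rbrakk> \<Longrightarrow>
           (1 - t) * g X + t * g Y \<le> g (\<lambda>i. (1 - t) * X i + t * Y i)"
  shows "ext_concave_on S (\<lambda>X. ereal (g X))"
  using assms by (simp add: ext_concave_on_def pointwise_convex_def)

text \<open>Multiplication by a nonnegative real distributes over every sum in \<open>ereal\<close>, so the two
  inequalities add even where a summand is \<open>-\<infinity>\<close>.\<close>

lemma ext_concave_on_add:
  assumes f: "ext_concave_on S f" and g: "ext_concave_on S g"
  shows "ext_concave_on S (\<lambda>X. f X + g X)"
  unfolding ext_concave_on_def
proof (intro conjI ballI)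
  fix X assume "X \<in> S"
  then show "f X + g X \<noteq> \<infinity>"
    using f g by (simp add: ext_concave_on_def)
next
  fix X Y and t :: real assume XY: "X \<in> S" "Y \<in> S" and t: "t \<in> {0..1}"
  let ?Z = "\<lambda>i. (1 - t) * X i + t * Y i"
  show "?Z \<in> S"
    using f XY t by (simp add: ext_concave_on_def)
  have "ereal (1 - t) * (f X + g X) + ereal t * (f Y + g Y) =
      (ereal (1 - t) * f X + ereal t * f Y) + (ereal (1 - t) * g X + ereal t * g Y)"
    using t by (simp add: distrib_left_ereal_nn mult.commute[of "ereal t"]
        mult.commute[of "ereal (1 - t)"] add.assoc add.left_commute)
  also have "\<dots> \<le> f ?Z + g ?Z"
    using f g XY t by (intro add_mono) (auto simp: ext_concave_on_def)
  finally show "ereal (1 - t) * (f X + g X) + ereal t * (f Y + g Y) \<le> f ?Z + g ?Z" .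
qed

lemma ext_concave_on_zero: "pointwise_convex S \<Longrightarrow> ext_concave_on S (\<lambda>X. 0)"
  using ext_concave_on_real[of S "\<lambda>X. 0"] by (simp add: zero_ereal_def)

lemma ext_concave_on_sum:
  assumes "pointwise_convex S" "\<And>i. i \<in> A \<Longrightarrow> ext_concave_on S (f i)"
  shows "ext_concave_on S (\<lambda>X. \<Sum>i\<in>A. f i X)"
  using assms(2)
  by (induction A rule: infinite_finite_induct)
     (auto intro: ext_concave_on_add ext_concave_on_zero assms(1))

lemma ext_concave_on_sum_mset:
  assumes "pointwise_convex S" "\<And>h. h \<in># H \<Longrightarrow> ext_concave_on S (f h)"
  shows "ext_concave_on S (\<lambda>X. \<Sum>h\<in>#H. f h X)"
  using assms(2)
  by (induction H) (auto intro: ext_concave_on_add ext_concave_on_zero assms(1))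

text \<open>At the endpoints \<open>0 * (-\<infinity>) = 0\<close> removes an infinite value of weight zero, so these are
  separated from the interior weights.\<close>

lemma ext_ln_concave:
  assumes "0 \<le> t" "t \<le> 1"
  shows "ereal (1 - t) * ext_ln x + ereal t * ext_ln y \<le> ext_ln ((1 - t) * x + t * y)"
proof -
  consider "t = 0" | "t = 1" | "0 < t" "t < 1" using assms by linarith
  then show ?thesis
  proof cases
    case 1 then show ?thesis by (simp add: zero_ereal_def[symmetric] one_ereal_def[symmetric])
  next
    case 2 then show ?thesis by (simp add: zero_ereal_def[symmetric] one_ereal_def[symmetric])
  next
    case 3
    show ?thesis
    proof (cases "x \<le> 0 \<or> y \<le> 0")
      case True
      \<comment> \<open>Both weights are positive here, so one infinite value makes the left-hand side \<open>-\<infinity>\<close>.\<close>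
      then show ?thesis using 3 by (auto simp: ext_ln_def)
    next
      case False
      then have "0 < (1 - t) * x + t * y"
        using 3 by (simp add: add_pos_pos)
      moreover have "(1 - t) * ln x + t * ln y \<le> ln ((1 - t) * x + t * y)"
        using False 3 concave_onD[OF ln_concave, of t x y] by simp
      ultimately show ?thesis using False by (simp add: ext_ln_def)
    qed
  qed
qed

lemma ext_concave_on_ext_ln_linear:
  assumes "pointwise_convex S"
    and "\<And>X Y t. L (\<lambda>i. (1 - t) * X i + t * Y i) = (1 - t) * L X + t * L Y"
  shows "ext_concave_on S (\<lambda>X. ext_ln (L X))"
  using assms(1) ext_ln_concave
  by (simp add: ext_concave_on_def pointwise_convex_def assms(2)) (simp add: ext_ln_def)

section \<open>Linearity and integrability of the intensity\<close>

lemma intensity_affine_combination: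
  "intensity d K \<alpha> h u s (\<lambda>i. (1 - t) * X i + t * Y i) =
     (1 - t) * intensity d K \<alpha> h u s X + t * intensity d K \<alpha> h u s Y"
  by (simp only: intensity_def distrib_right sum.distrib distrib_left sum_distrib_left mult.assoc
      ac_simps)

lemma absolutely_integrable_cut_off:
  fixes f :: "real \<Rightarrow> real"
  assumes "continuous_on {a..b} f"
  shows "(\<lambda>s. if c < s then f s else 0) absolutely_integrable_on {a..b}"
proof -
  have "f absolutely_integrable_on {a..b}"
    using assms by (rule absolutely_integrable_continuous_real)
  then have "f absolutely_integrable_on ({a..b} \<inter> {c<..})"
    by (rule set_integrable_subset) auto
  then show ?thesis
    unfolding set_integrable_def
    by (rule Bochner_Integration.integrable_cong[THEN iffD1, OF refl, rotated])
       (auto simp: indicator_def)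
qed

text \<open>The jumps at the event times make the intensity discontinuous, so integrability is assembled
  from the contributions of the single events.\<close>

lemma intensity_absolutely_integrable:
  "(\<lambda>s. intensity d K \<alpha> h u s X) absolutely_integrable_on {a..b}"
proof -
  \<comment> \<open>The index set of the inner sum varies with \<open>s\<close>; moving this dependence into the summands
    leaves a fixed finite sum of functions of \<open>s\<close>.\<close>
  have cut_off: "(\<Sum>j | j < n_events h \<and> event_time h j < s \<and> event_type h j = v.
        exp (- real (k + 1) * \<alpha> * (s - event_time h j))) =
      (\<Sum>j | j < n_events h \<and> event_type h j = v.
        if event_time h j < s then exp (- real (k + 1) * \<alpha> * (s - event_time h j)) else 0)"
    for k v s
    by (rule sum.mono_neutral_cong_left) auto
  have background: "(\<lambda>s. exp (- real k * \<alpha> * s)) absolutely_integrable_on {a..b}" for k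
    by (intro absolutely_integrable_continuous_real continuous_intros)
  have triggered: "(\<lambda>s. if event_time h j < s
      then exp (- real (k + 1) * \<alpha> * (s - event_time h j)) else 0)
      absolutely_integrable_on {a..b}" for k j
    by (intro absolutely_integrable_cut_off continuous_intros)
  show ?thesis
    unfolding intensity_def cut_off
    by (intro set_integral_add absolutely_integrable_sum set_integrable_mult_right
        background triggered finite_atLeastAtMost) auto
qed

section \<open>Concavity of the log-likelihood\<close>

lemma positive_part_intensity_integrable:
  "(\<lambda>s. max (intensity d K \<alpha> h u s X) 0) integrable_on {a..b}"
  by (intro set_lebesgue_integral_eq_integral(1) absolutely_integrable_max_1
      intensity_absolutely_integrable absolutely_integrable_continuous_real continuous_intros)

lemma integral_positive_part_intensity_convex:
  assumes "0 \<le> t" "t \<le> 1"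
  shows "integral {a..b} (\<lambda>s. max (intensity d K \<alpha> h u s (\<lambda>i. (1 - t) * X i + t * Y i)) 0)
    \<le> (1 - t) * integral {a..b} (\<lambda>s. max (intensity d K \<alpha> h u s X) 0)
      + t * integral {a..b} (\<lambda>s. max (intensity d K \<alpha> h u s Y) 0)"
proof -
  let ?p = "\<lambda>X s. max (intensity d K \<alpha> h u s X) 0"
  have pos_part: "max ((1 - t) * x + t * y) 0 \<le> (1 - t) * max x 0 + t * max y 0" for x y :: real
    using assms by (intro max.boundedI add_mono mult_left_mono) auto
  have "integral {a..b} (?p (\<lambda>i. (1 - t) * X i + t * Y i))
      \<le> integral {a..b} (\<lambda>s. (1 - t) * ?p X s + t * ?p Y s)"
    by (intro integral_le positive_part_intensity_integrable integrable_add
        integrable_on_mult_right)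
       (simp only: intensity_affine_combination pos_part)
  also have "\<dots> = (1 - t) * integral {a..b} (?p X) + t * integral {a..b} (?p Y)"
    by (simp add: integral_add positive_part_intensity_integrable integrable_on_mult_right)
  finally show ?thesis .
qed

text \<open>Splitting the compensator over realizations and types reduces concavity to single terms.
  This is valid in \<open>ereal\<close> because the compensator is finite.\<close>

lemma log_likelihood_split:
  "log_likelihood d K \<alpha> H X =
     (\<Sum>h\<in>#H. \<Sum>i<n_events h. ext_ln (intensity d K \<alpha> h (event_type h i) (event_time h i) X)) +
     (\<Sum>h\<in>#H. \<Sum>u=1..d. ereal (- integral {period_start h..period_end h}
       (\<lambda>s. max (intensity d K \<alpha> h u s X) 0)))"
proof -
  have "ereal (- (\<Sum>h\<in>#H. g h)) = (\<Sum>h\<in>#H. ereal (- g h))" for g :: "realization \<Rightarrow> real"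
  proof (induction H)
    case (add h H)
    have "ereal (- (\<Sum>h\<in>#add_mset h H. g h)) = ereal (- g h) + ereal (- (\<Sum>h\<in>#H. g h))"
      by simp
    then show ?case by (simp only: add.IH image_mset_add_mset sum_mset.add_mset)
  qed (simp add: zero_ereal_def)
  then show ?thesis
    by (simp add: log_likelihood_def minus_ereal_def sum_negf)
qed

theorem proposition3:
  fixes d K :: nat and \<alpha> :: real and H :: "realization multiset"
  assumes "d \<ge> 1" and "K \<ge> 1" and "\<alpha> > 0"
    and "\<And>h. h \<in># H \<Longrightarrow> valid_realization d h"
  shows "ext_concave_on (vectors_on (coeff_index d K)) (log_likelihood d K \<alpha> H)"
proof -
  note convex = pointwise_convex_vectors_on[of "coeff_index d K"]
  have event_terms: "ext_concave_on (vectors_on (coeff_index d K))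
      (\<lambda>X. ext_ln (intensity d K \<alpha> h u s X))" for h u s
    by (intro ext_concave_on_ext_ln_linear convex intensity_affine_combination)
  have compensator_terms: "ext_concave_on (vectors_on (coeff_index d K))
      (\<lambda>X. ereal (- integral {a..b} (\<lambda>s. max (intensity d K \<alpha> h u s X) 0)))" for h u a b
  proof (rule ext_concave_on_real[OF convex])
    fix X Y :: "nat \<times> nat \<times> nat \<Rightarrow> real" and t :: real
    assume "0 \<le> t" "t \<le> 1"
    from integral_positive_part_intensity_convex[OF this, of a b d K \<alpha> h u X Y]
    show "(1 - t) * - integral {a..b} (\<lambda>s. max (intensity d K \<alpha> h u s X) 0)
        + t * - integral {a..b} (\<lambda>s. max (intensity d K \<alpha> h u s Y) 0)
      \<le> - integral {a..b}
          (\<lambda>s. max (intensity d K \<alpha> h u s (\<lambda>i. (1 - t) * X i + t * Y i)) 0)"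
      by linarith
  qed
  show ?thesis
    unfolding log_likelihood_split
    by (intro ext_concave_on_add ext_concave_on_sum_mset ext_concave_on_sum convex
        event_terms compensator_terms)
qed

end
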